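(* Let the data and notation be as in the context, where $(a_c,\psi)$ is one of the four corrections listed there, and let $\tau:I^+\to[0,1)$ be the map defined there. Consider the system in the unknowns $(\varphi,a,a')$ $$\text{(C1)}\ \tan\varphi=\frac{1-a}{\lambda(1+a')},$$ $$\text{(C2)}\ \frac{a}{1-a}=\frac{1}{\sin^2\varphi}\bigl(\mu_L^c(\varphi)\cos\varphi+\mu_D^c(\varphi)\sin\varphi\bigr)-\frac{\psi((a-a_c)_+)}{(1-a)^2},$$ $$\text{(C3)}\ \frac{a'}{1-a}=\frac{1}{\lambda\sin^2\varphi}\bigl(\mu_L^c(\varphi)\sin\varphi-\mu_D^c(\varphi)\cos\varphi\bigr).$$ (i) If $(\varphi,a,a')\in (I^+\setminus\{\frac\pi2\})\times[0,1)\times(\mathbb{R}\setminus\{-1\})$ satisfies (C1), (C2), (C3), then $$\mu_L^c(\varphi)-\tan(\theta-\varphi)\,\mu_D^c(\varphi)=\mu_G^c(\varphi),\qquad(\mathrm{E})$$ where $$\mu_G^c(\varphi):=\sin\varphi\tan(\theta-\varphi)+\frac{\cos\theta\,\sin^2\varphi}{\cos(\theta-\varphi)}\,\frac{\psi((\tau(\varphi)-a_c)_+)}{(1-\tau(\varphi))^2}.$$ (ii) Conversely, suppose that $\varphi\in I^+\setminus\{\frac\pi2\}$ satisfies (E) and define $$a=\tau(\varphi),\qquad a'=\frac{1-\tau(\varphi)}{\lambda\sin^2\varphi}\bigl(\mu_L^c(\varphi)\sin\varphi-\mu_D^c(\varphi)\cos\varphi\bigr).$$ Then $(\varphi,a,a')\in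 (I^+\setminus\{\frac\pi2\})\times[0,1)\times(\mathbb{R}\setminus\{-1\})$ and $(\varphi,a,a')$ satisfies (C1), (C2), (C3).
   Context: Fixed data: real numbers $\lambda>0$ (local speed ratio), $\sigma>0$ (solidity), $\gamma\in(-\frac\pi2,\frac\pi2)$ (twist), $\beta>0$ with $|\gamma|\le\beta$; an integer $B\ge1$ (number of blades) and $s\in(0,1)$ (relative radial position $r/R$); a function $C_L:[-\beta,\beta]\to\mathbb{R}$ continuous on $[-\beta,\beta]$ and positive on $(0,\beta]$; a function $C_D:\mathbb{R}\to\mathbb{R}$ continuous and non-negative. Notation: $\theta\in(0,\frac\pi2)$ is defined by $\tan\theta=1/\lambda$; $I:=[-\beta+\gamma,\beta+\gamma]\cap(-\frac\pi2+\theta,\frac\pi2+\theta)$ and $I^+:=I\cap(0,\theta]$, so $I^+=(0,\min\{\theta,\beta+\gamma\}]$. The tip loss factor is $F(\varphi):=\frac2\pi\arccos\Bigl(\exp\bigl(-\frac{(B/2)(1-s)}{s\,\sin\varphi}\bigr)\Bigr)$ for $\varphi\in(0,\frac\pi2)$. $\mu_L^c(\varphi):=\frac{\sigma}{4F(\varphi)}C_L(\varphi-\gamma)$, $\mu_D^c(\varphi):=\frac{\sigma}{4F(\varphi)}C_D(\varphi-\gamma)$. $(y)_+:=\max\{0,y\}$. The corrections $(a_c,\psi)$, with $x=(a-a_c)_+$, $a\in[0,1)$: (1) Glauert: $a_c=\frac13$, $\psi(x)=\frac x4\bigl(\frac{x^2}{a_c}+2x+a_c\bigr)$; (2) empirical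 Glauert: $a_c=\frac25$, $\psi((a-a_c)_+)=\bigl(\frac{1}{2(1-a_c)}-\frac{\nu}{4}(1-a)\bigr)(a-a_c)_+$ with $\nu=5.5563$, and in this case $F\equiv1$ in all formulas; (3) Buhl: $a_c=\frac25$, $\psi(x)=\frac{1}{2F(\varphi)}\bigl(\frac{x}{1-a_c}\bigr)^2$ (so $\psi$ also depends on $\varphi$ through $F$); (4) Wilson et al./Spera: $a_c=\frac13$, $\psi(x)=x^2$. Definition of $\tau$: for $\varphi\in I^+$ put $g(\varphi):=\cot\varphi\,\tan(\theta-\varphi)+\frac{\mu_D^c(\varphi)}{\sin\varphi}\bigl(1+\cot\varphi\,\tan(\theta-\varphi)\bigr)$. For each $\varphi\in I^+$, $\tau(\varphi)$ is the unique $a\in[0,1)$ such that $$\frac{a}{1-a}+\frac{\sin\theta\sin\varphi}{\cos(\theta-\varphi)}\,\frac{\psi((a-a_c)_+)}{(1-a)^2}=g(\varphi)$$ (existence and uniqueness hold). *)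

theory Defs
  imports Complex_Main
begin

datatype correction = Glauert | Empirical_Glauert | Buhl | Wilson_Spera

definition a_crit :: "correction \<Rightarrow> real" where
  "a_crit c = (case c of Glauert \<Rightarrow> 1/3 | Empirical_Glauert \<Rightarrow> 2/5 | Buhl \<Rightarrow> 2/5 | Wilson_Spera \<Rightarrow> 1/3)"

text \<open>The argument \<open>f\<close> is the value of the tip loss factor at the current angle; only Buhl's
  correction uses it. The empirical Glauert correction is usually written with the factor \<open>1 - a\<close>;
  since \<open>a = a\<^sub>c + x\<close> whenever \<open>x = (a - a\<^sub>c)\<^sub>+\<close> is nonzero, that factor becomes
  \<open>1 - a\<^sub>c - x\<close> (see \<open>psi_Empirical_Glauert\<close>).\<close>

definition psi :: "correction \<Rightarrow> real \<Rightarrow> real \<Rightarrow> real" where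
  "psi c f x = (let a\<^sub>c = a_crit c in
     case c of
       Glauert \<Rightarrow> x/4 * (x\<^sup>2 / a\<^sub>c + 2 * x + a\<^sub>c)
     | Empirical_Glauert \<Rightarrow> (1 / (2 * (1 - a\<^sub>c)) - 5.5563 / 4 * (1 - a\<^sub>c - x)) * x
     | Buhl \<Rightarrow> 1 / (2 * f) * (x / (1 - a\<^sub>c))\<^sup>2
     | Wilson_Spera \<Rightarrow> x\<^sup>2)"

definition pos_part :: "real \<Rightarrow> real" where
  "pos_part y = max 0 y"

lemma psi_Empirical_Glauert:
  fixes a f :: real
  defines "a\<^sub>c \<equiv> a_crit Empirical_Glauert"
  shows "psi Empirical_Glauert f (pos_part (a - a\<^sub>c)) =
    (1 / (2 * (1 - a\<^sub>c)) - 5.5563 / 4 * (1 - a)) * pos_part (a - a\<^sub>c)"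
  by (cases "a \<le> a\<^sub>c") (simp_all add: psi_def pos_part_def a\<^sub>c_def Let_def)

text \<open>By convention the empirical Glauert correction is used without tip loss.\<close>

definition tip_loss :: "correction \<Rightarrow> nat \<Rightarrow> real \<Rightarrow> real \<Rightarrow> real" where
  "tip_loss c B s \<phi> =
     (if c = Empirical_Glauert then 1
      else 2 / pi * arccos (exp (- ((real B / 2 * (1 - s)) / (s * sin \<phi>)))))"

definition angle_set :: "real \<Rightarrow> real \<Rightarrow> real \<Rightarrow> real set" where
  "angle_set \<beta> \<gamma> \<theta> = {-\<beta> + \<gamma> .. \<beta> + \<gamma>} \<inter> {-pi/2 + \<theta> <..< pi/2 + \<theta>}"

definition angle_set_plus :: "real \<Rightarrow> real \<Rightarrow> real \<Rightarrow> real set" where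
  "angle_set_plus \<beta> \<gamma> \<theta> = angle_set \<beta> \<gamma> \<theta> \<inter> {0 <.. \<theta>}"

text \<open>\<open>mu \<sigma> F C \<gamma>\<close> is \<open>\<mu>\<^sub>L\<^sup>c\<close> for \<open>C = C\<^sub>L\<close> and \<open>\<mu>\<^sub>D\<^sup>c\<close> for \<open>C = C\<^sub>D\<close>.\<close>

definition mu :: "real \<Rightarrow> (real \<Rightarrow> real) \<Rightarrow> (real \<Rightarrow> real) \<Rightarrow> real \<Rightarrow> real \<Rightarrow> real" where
  "mu \<sigma> F C \<gamma> \<phi> = \<sigma> / (4 * F \<phi>) * C (\<phi> - \<gamma>)"

definition g_rhs :: "real \<Rightarrow> (real \<Rightarrow> real) \<Rightarrow> real \<Rightarrow> real" where
  "g_rhs \<theta> \<mu>\<^sub>D \<phi> = cot \<phi> * tan (\<theta> - \<phi>) + \<mu>\<^sub>D \<phi> / sin \<phi> * (1 + cot \<phi> * tan (\<theta> - \<phi>))"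

definition tau :: "correction \<Rightarrow> (real \<Rightarrow> real) \<Rightarrow> real \<Rightarrow> (real \<Rightarrow> real) \<Rightarrow> real \<Rightarrow> real" where
  "tau c F \<theta> \<mu>\<^sub>D \<phi> = (THE a. a \<in> {0..<1} \<and>
     a / (1 - a)
       + sin \<theta> * sin \<phi> / cos (\<theta> - \<phi>) * (psi c (F \<phi>) (pos_part (a - a_crit c)) / (1 - a)\<^sup>2)
     = g_rhs \<theta> \<mu>\<^sub>D \<phi>)"

definition mu_G :: "correction \<Rightarrow> (real \<Rightarrow> real) \<Rightarrow> real \<Rightarrow> (real \<Rightarrow> real) \<Rightarrow> real \<Rightarrow> real" where
  "mu_G c F \<theta> \<tau> \<phi> = sin \<phi> * tan (\<theta> - \<phi>)
     + cos \<theta> * (sin \<phi>)\<^sup>2 / cos (\<theta> - \<phi>)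
       * (psi c (F \<phi>) (pos_part (\<tau> \<phi> - a_crit c)) / (1 - \<tau> \<phi>)\<^sup>2)"

definition C1 :: "real \<Rightarrow> real \<Rightarrow> real \<Rightarrow> real \<Rightarrow> bool" where
  "C1 lam \<phi> a a' \<longleftrightarrow> tan \<phi> = (1 - a) / (lam * (1 + a'))"

definition C2 ::
  "correction \<Rightarrow> (real \<Rightarrow> real) \<Rightarrow> (real \<Rightarrow> real) \<Rightarrow> (real \<Rightarrow> real) \<Rightarrow> real \<Rightarrow> real \<Rightarrow> bool" where
  "C2 c F \<mu>\<^sub>L \<mu>\<^sub>D \<phi> a \<longleftrightarrow>
     a / (1 - a) = 1 / (sin \<phi>)\<^sup>2 * (\<mu>\<^sub>L \<phi> * cos \<phi> + \<mu>\<^sub>D \<phi> * sin \<phi>)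
       - psi c (F \<phi>) (pos_part (a - a_crit c)) / (1 - a)\<^sup>2"

definition C3 ::
  "real \<Rightarrow> (real \<Rightarrow> real) \<Rightarrow> (real \<Rightarrow> real) \<Rightarrow> real \<Rightarrow> real \<Rightarrow> real \<Rightarrow> bool" where
  "C3 lam \<mu>\<^sub>L \<mu>\<^sub>D \<phi> a a' \<longleftrightarrow>
     a' / (1 - a) = 1 / (lam * (sin \<phi>)\<^sup>2) * (\<mu>\<^sub>L \<phi> * sin \<phi> - \<mu>\<^sub>D \<phi> * cos \<phi>)"

end

theory Submission
  imports Defs
begin

text \<open>Put \<open>u = 1 / (1 - a)\<close> and \<open>P = \<psi> u\<^sup>2\<close>. Eliminating \<open>a'\<close> between (C1) and (C3) gives an
  equation linear in \<open>u\<close>, \<open>\<mu>\<^sub>L\<close> and \<open>\<mu>\<^sub>D\<close>, and (C2) is a second one. Eliminating \<open>\<mu>\<^sub>L\<close> from this pair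
  yields the equation that defines \<open>\<tau>\<close>; eliminating \<open>u\<close> yields (E). The two combinations have
  nonzero determinant, so nothing is lost. It remains to see that the equation for \<open>\<tau>\<close> has exactly
  one solution: its left side is continuous and strictly increasing in \<open>a\<close>, starts at \<open>0\<close>, and is
  unbounded.\<close>

subsection \<open>The defining equation of \<open>\<tau>\<close>\<close>

text \<open>\<open>f\<close> stands for the tip loss value and \<open>K\<close> for
  \<open>sin \<theta> * sin \<phi> / cos (\<theta> - \<phi>)\<close>. The analysis is then in
  \<open>a\<close> alone; this angle factor enters only through the bounds
  \<open>0 \<le> K \<le> 1\<close>.\<close>

definition tau_lhs :: "correction \<Rightarrow> real \<Rightarrow> real \<Rightarrow> real \<Rightarrow> real" where
  "tau_lhs c f K a = a / (1 - a) + K * (psi c f (pos_part (a - a_crit c)) / (1 - a)\<^sup>2)"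

text \<open>Outside the empirical Glauert case, \<open>psi\<close> is a polynomial in
  \<open>x\<close> with non-negative coefficients.\<close>

lemma psi_mono:
  assumes "c \<noteq> Empirical_Glauert" "f > 0" "0 \<le> x" "x \<le> y"
  shows "psi c f x \<le> psi c f y"
proof -
  have 2: "x\<^sup>2 \<le> y\<^sup>2" using assms by (intro power_mono) auto
  show ?thesis
  proof (cases c)
    case Glauert
    have "x / 4 * (x\<^sup>2 * 3 + 2 * x + 1/3) \<le> y / 4 * (y\<^sup>2 * 3 + 2 * y + 1/3)"
      using assms 2 by (intro mult_mono add_mono) auto
    then show ?thesis using Glauert by (simp add: psi_def a_crit_def)
  next
    case Buhl
    have "(x / (3/5))\<^sup>2 \<le> (y / (3/5))\<^sup>2" using 2 by (simp add: power_divide)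
    then have "1 / (2 * f) * (x / (3/5))\<^sup>2 \<le> 1 / (2 * f) * (y / (3/5))\<^sup>2"
      using assms by (intro mult_left_mono) auto
    then show ?thesis using Buhl by (simp add: psi_def a_crit_def)
  qed (use assms 2 in \<open>auto simp: psi_def a_crit_def\<close>)
qed

lemma psi_0 [simp]: "psi c f 0 = 0"
  by (cases c) (auto simp: psi_def Let_def)

lemma continuous_on_psi [continuous_intros]:
  assumes "continuous_on A h" "f > 0"
  shows "continuous_on A (\<lambda>x. psi c f (h x))"
  using assms by (cases c) (auto simp: psi_def Let_def a_crit_def intro!: continuous_intros)

text \<open>The empirical Glauert \<open>\<psi>\<close> is slightly negative just above \<open>a\<^sub>c\<close>, because
  \<open>5.5563 / 4 \<cdot> (1 - a\<^sub>c)\<close> exceeds \<open>1 / (2 (1 - a\<^sub>c))\<close> by about \<open>10\<^sup>-\<^sup>4\<close>. Expressed in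
  \<open>y = (a - a\<^sub>c)\<^sub>+ / (1 - a)\<close> the correction term becomes a quadratic with a tiny negative linear
  coefficient, which the growth of \<open>a / (1 - a)\<close> absorbs.\<close>

lemma psi_Empirical_Glauert_scaled:
  fixes a :: real
  assumes "a < 1"
  defines "y \<equiv> pos_part (a - 2/5) / (1 - a)"
  shows "psi Empirical_Glauert f (pos_part (a - 2/5)) / (1 - a)\<^sup>2
           = 25/18 * y\<^sup>2 - 67/360000 * y"
proof (cases "a \<le> 2/5")
  case True
  then show ?thesis by (simp add: y_def pos_part_def)
next
  case False
  then have pos: "pos_part (a - 2/5) = a - 2/5" by (simp add: pos_part_def)
  then have p: "y * (1 - a) = a - 2/5" using assms by (simp add: y_def)
  \<comment> \<open>Above the threshold \<open>1 / (1 - a) = 5/3 * (1 + y)\<close>, so the quotient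
    is \<open>25/18 * (1 + y) * y - 5.5563/4 * y\<close>, and
    \<open>25/18 - 5.5563/4 = -67/360000\<close>.\<close>
  have "(25/18 * y\<^sup>2 - 67/360000 * y) * (1 - a)\<^sup>2
      = 25/18 * (a - 2/5)\<^sup>2 - 67/360000 * (a - 2/5) * (1 - a)"
    unfolding p[symmetric] by algebra
  also have "\<dots> = psi Empirical_Glauert f (a - 2/5)"
    by (simp add: psi_def a_crit_def) (simp add: field_simps power2_eq_square)
  finally have "psi Empirical_Glauert f (a - 2/5) = (25/18 * y\<^sup>2 - 67/360000 * y) * (1 - a)\<^sup>2" ..
  then show ?thesis unfolding pos using assms(1) by simp
qed

text \<open>Three corrections are monotone, so the difference is non-negative; the empirical one can
  decrease only through its tiny linear term. The constant 1/2 is a comfortable choice: far above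
  that coefficient, yet below 1, so that half the growth of \<open>a / (1 - a)\<close>
  survives.\<close>

lemma psi_scaled_diff_ge:
  assumes "f > 0" "0 \<le> a" "a \<le> b" "b < 1"
  shows "psi c f (pos_part (b - a_crit c)) / (1 - b)\<^sup>2 - psi c f (pos_part (a - a_crit c)) / (1 - a)\<^sup>2
           \<ge> - (1 / 2) * (b / (1 - b) - a / (1 - a))"
    (is "?r \<ge> _")
proof -
  define d where "d = b / (1 - b) - a / (1 - a)"
  have d: "0 \<le> d"
    using assms by (auto simp: d_def intro!: frac_le)
  show ?thesis
  proof (cases "c = Empirical_Glauert")
    case True
    define y where "y t = pos_part (t - 2/5) / (1 - t)" for t :: real
    have y: "0 \<le> y a" "y a \<le> y b"
      using assms by (auto simp: y_def pos_part_def intro!: frac_le)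
    have ydiff: "y b - y a \<le> d"
    proof -
      \<comment> \<open>Since \<open>1 / (1 - t) = 1 + t / (1 - t)\<close>, \<open>y\<close> is a
        truncated affine function of \<open>t / (1 - t)\<close> with slope 3/5.\<close>
      have eq: "y t = max 0 (3/5 * (t / (1 - t)) - 2/5)" if "t < 1" for t :: real
        using that by (auto simp: y_def pos_part_def max_def divide_simps; argo)
      have "y a = max 0 (3/5 * (a / (1 - a)) - 2/5)" "y b = max 0 (3/5 * (b / (1 - b)) - 2/5)"
        using assms by (simp_all only: eq)
      with d show ?thesis unfolding d_def by linarith
    qed
    have "(y a)\<^sup>2 \<le> (y b)\<^sup>2" using y by (intro power_mono) auto
    then have "- (1 / 2) * d
        \<le> (25/18 * (y b)\<^sup>2 - 67/360000 * y b) - (25/18 * (y a)\<^sup>2 - 67/360000 * y a)"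
      using ydiff d by linarith
    then show ?thesis
      using psi_Empirical_Glauert_scaled[of a f] psi_Empirical_Glauert_scaled[of b f] assms True
      unfolding d_def y_def[symmetric] by (simp add: a_crit_def)
  next
    case False
    have "psi c f (pos_part (a - a_crit c)) / (1 - a)\<^sup>2 \<le> psi c f (pos_part (b - a_crit c)) / (1 - b)\<^sup>2"
    proof (rule frac_le)
      show "psi c f (pos_part (a - a_crit c)) \<le> psi c f (pos_part (b - a_crit c))"
        using assms False by (intro psi_mono) (auto simp: pos_part_def)
      show "0 \<le> psi c f (pos_part (b - a_crit c))"
        using psi_mono[OF False assms(1), of 0 "pos_part (b - a_crit c)"] by (simp add: pos_part_def)
      show "(1 - b)\<^sup>2 \<le> (1 - a)\<^sup>2" using assms by (intro power_mono) auto
    qed (use assms in auto)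
    then have "0 \<le> ?r" by simp
    with d have "- (1 / 2) * d \<le> ?r" by linarith
    then show ?thesis by (simp only: d_def)
  qed
qed

text \<open>This single estimate gives both strict monotonicity and, taking \<open>a = 0\<close>, unboundedness.\<close>

lemma tau_lhs_diff_ge:
  assumes "f > 0" "0 \<le> K" "K \<le> 1" "0 \<le> a" "a \<le> b" "b < 1"
  shows "tau_lhs c f K b - tau_lhs c f K a \<ge> (1 / 2) * (b / (1 - b) - a / (1 - a))"
proof -
  define d where "d = b / (1 - b) - a / (1 - a)"
  define e where "e = psi c f (pos_part (b - a_crit c)) / (1 - b)\<^sup>2
    - psi c f (pos_part (a - a_crit c)) / (1 - a)\<^sup>2"
  have "d \<ge> 0" using assms by (auto simp: d_def intro!: frac_le)
  then have "K * d \<le> d" using assms by (simp add: mult_left_le_one_le)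
  moreover have "- (1 / 2) * d \<le> e"
    using psi_scaled_diff_ge[OF assms(1,4-6)] by (simp add: d_def e_def)
  then have "K * (- (1 / 2) * d) \<le> K * e" using assms by (intro mult_left_mono)
  moreover have "tau_lhs c f K b - tau_lhs c f K a = d + K * e"
    by (simp add: tau_lhs_def d_def e_def right_diff_distrib)
  ultimately have "tau_lhs c f K b - tau_lhs c f K a \<ge> 1 / 2 * d" by simp
  then show ?thesis by (simp only: d_def)
qed

lemma tau_lhs_strict_mono:
  assumes "f > 0" "0 \<le> K" "K \<le> 1" "0 \<le> a" "a < b" "b < 1"
  shows "tau_lhs c f K a < tau_lhs c f K b"
proof -
  have "a / (1 - a) < b / (1 - b)" using assms by (simp add: divide_simps algebra_simps)
  then have "0 < 1 / 2 * (b / (1 - b) - a / (1 - a))" by simp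
  also have "\<dots> \<le> tau_lhs c f K b - tau_lhs c f K a"
    using assms by (intro tau_lhs_diff_ge) auto
  finally show ?thesis by simp
qed

lemma tau_lhs_ex1:
  assumes "f > 0" "0 \<le> K" "K \<le> 1" "0 \<le> g"
  shows "\<exists>!a. a \<in> {0..<1} \<and> tau_lhs c f K a = g"
proof (rule ex_ex1I)
  \<comment> \<open>Chosen so that \<open>t / (1 - t) = 2 * g\<close>; the factor 2 makes up for the
    1/2 in \<open>tau_lhs_diff_ge\<close>.\<close>
  define t where "t = 2 * g / (1 + 2 * g)"
  have t: "0 \<le> t" "t < 1" using assms by (auto simp: t_def)
  have "1 - t = 1 / (1 + 2 * g)" using assms by (simp add: t_def field_simps)
  then have "t / (1 - t) = 2 * g" using assms by (simp add: t_def)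
  moreover have 0: "tau_lhs c f K 0 = 0"
    by (cases c) (auto simp: tau_lhs_def pos_part_def a_crit_def)
  ultimately have "g \<le> tau_lhs c f K t"
    using tau_lhs_diff_ge[of f K 0 t c] assms t by simp
  moreover have "continuous_on {0..t} (tau_lhs c f K)"
    unfolding tau_lhs_def pos_part_def using assms t by (intro continuous_intros) auto
  ultimately obtain a where "0 \<le> a" "a \<le> t" "tau_lhs c f K a = g"
    using IVT'[of "tau_lhs c f K" 0 g t] 0 assms t by auto
  with t show "\<exists>a. a \<in> {0..<1} \<and> tau_lhs c f K a = g" by auto
next
  fix a b
  assume "a \<in> {0..<1} \<and> tau_lhs c f K a = g" "b \<in> {0..<1} \<and> tau_lhs c f K b = g"
  then show "a = b"
    using tau_lhs_strict_mono[OF assms(1-3), of a b c] tau_lhs_strict_mono[OF assms(1-3), of b a c]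
    by (cases a b rule: linorder_cases) auto
qed

text \<open>The exponent is strictly negative, so the argument of \<open>arccos\<close> stays
  strictly below 1.\<close>

lemma tip_loss_pos:
  assumes "B \<ge> 1" "0 < s" "s < 1" "sin \<phi> > 0"
  shows "tip_loss c B s \<phi> > 0"
proof -
  have "exp (- ((real B / 2 * (1 - s)) / (s * sin \<phi>))) < 1"
    using assms by simp
  then have "0 < arccos (exp (- ((real B / 2 * (1 - s)) / (s * sin \<phi>))))"
    using arccos_less_arccos[of "exp (- ((real B / 2 * (1 - s)) / (s * sin \<phi>)))" 1]
    by (smt (verit) arccos_1 exp_gt_zero)
  then show ?thesis by (simp add: tip_loss_def)
qed

subsection \<open>Elimination\<close>

text \<open>Here \<open>u = 1 / (1 - a)\<close> and \<open>cos \<theta> / sin \<theta>\<close> is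
  the speed ratio. Treating \<open>P\<close> as an opaque number makes both systems linear in
  \<open>u\<close>, \<open>L\<close>, \<open>D\<close> and \<open>P\<close>.\<close>

lemma system_elimination:
  fixes \<theta> \<phi> u P L D :: real
  assumes S: "sin \<phi> > 0" and s: "sin \<theta> > 0" and Q: "cos (\<theta> - \<phi>) > 0"
  shows "u * (cos \<theta> / sin \<theta>) = cot \<phi> - 1 / (sin \<phi>)\<^sup>2 * (L * sin \<phi> - D * cos \<phi>)
           \<and> u - 1 = 1 / (sin \<phi>)\<^sup>2 * (L * cos \<phi> + D * sin \<phi>) - P
       \<longleftrightarrow> u - 1 + sin \<theta> * sin \<phi> / cos (\<theta> - \<phi>) * P
             = cot \<phi> * tan (\<theta> - \<phi>) + D / sin \<phi> * (1 + cot \<phi> * tan (\<theta> - \<phi>))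
           \<and> L - tan (\<theta> - \<phi>) * D
             = sin \<phi> * tan (\<theta> - \<phi>) + cos \<theta> * (sin \<phi>)\<^sup>2 / cos (\<theta> - \<phi>) * P"
    (is "?A \<and> ?B \<longleftrightarrow> ?T \<and> ?E")
proof -
  define x X y Y where defs: "x = sin \<phi>" "X = cos \<phi>" "y = sin \<theta>" "Y = cos \<theta>"
  define q where "q = Y * X + y * x"
  define r where "r = y * X - Y * x"
  have q: "cos (\<theta> - \<phi>) = q" and r: "sin (\<theta> - \<phi>) = r"
    by (simp_all add: q_def r_def defs cos_diff sin_diff)
  have pyth: "x\<^sup>2 + X\<^sup>2 = 1" by (simp add: defs)
  have nz: "x \<noteq> 0" "y \<noteq> 0" "q \<noteq> 0" using S s Q q by (auto simp: defs)
  have A: "?A \<longleftrightarrow> u * Y * x\<^sup>2 = y * (X * x - L * x + D * X)"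
    unfolding cot_def defs[symmetric] using nz
    by (simp add: divide_simps power2_eq_square) (simp add: algebra_simps)
  have B: "?B \<longleftrightarrow> (u - 1 + P) * x\<^sup>2 = L * X + D * x"
    unfolding cot_def defs[symmetric] using nz
    by (auto simp: field_simps)
  have T: "?T \<longleftrightarrow> (u - 1) * q * x\<^sup>2 + y * x^3 * P = X * x * r + D * (x * q + X * r)"
    unfolding cot_def tan_def q r defs[symmetric] using nz
    by (simp add: divide_simps power2_eq_square power3_eq_cube) (auto simp: algebra_simps)
  have E: "?E \<longleftrightarrow> L * q - r * D = x * r + Y * x\<^sup>2 * P"
    unfolding tan_def q r defs[symmetric] using nz
    by (simp add: field_simps)
  show ?thesis unfolding A B T E
  proof (intro iffI conjI)
    assume "u * Y * x\<^sup>2 = y * (X * x - L * x + D * X) \<and> (u - 1 + P) * x\<^sup>2 = L * X + D * x"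
    then have a: "u * Y * x\<^sup>2 = y * (X * x - L * x + D * X)"
      and b: "(u - 1 + P) * x\<^sup>2 = L * X + D * x" by auto
    \<comment> \<open>This is \<open>X\<close> times \<open>a\<close> plus \<open>y * x\<close>
      times \<open>b\<close>, where \<open>L\<close> cancels; the next goal is \<open>a\<close>
      minus \<open>Y\<close> times \<open>b\<close>, where \<open>u\<close> cancels.\<close>
    show "(u - 1) * q * x\<^sup>2 + y * x^3 * P = X * x * r + D * (x * q + X * r)"
      using a b pyth unfolding q_def r_def by algebra
    show "L * q - r * D = x * r + Y * x\<^sup>2 * P"
      using a b pyth unfolding q_def r_def by algebra
  next
    assume "(u - 1) * q * x\<^sup>2 + y * x^3 * P = X * x * r + D * (x * q + X * r)
      \<and> L * q - r * D = x * r + Y * x\<^sup>2 * P"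
    then have t: "(u - 1) * q * x\<^sup>2 + y * x^3 * P = X * x * r + D * (x * q + X * r)"
      and e: "L * q - r * D = x * r + Y * x\<^sup>2 * P" by auto
    \<comment> \<open>Those two combinations have determinant \<open>- q\<close>. Inverting them,
      \<open>Y\<close> times \<open>t\<close> plus \<open>y * x\<close> times \<open>e\<close> gives
      \<open>q\<close> times the first equation, and \<open>t\<close> minus \<open>X\<close> times
      \<open>e\<close> gives \<open>q\<close> times the second.\<close>
    have "q * (u * Y * x\<^sup>2) = q * (y * (X * x - L * x + D * X))"
      using t e pyth unfolding q_def r_def by algebra
    then show "u * Y * x\<^sup>2 = y * (X * x - L * x + D * X)" using nz by simp
    have "q * ((u - 1 + P) * x\<^sup>2) = q * (L * X + D * x)"
      using t e pyth unfolding q_def r_def by algebra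
    then show "(u - 1 + P) * x\<^sup>2 = L * X + D * x" using nz by simp
  qed
qed

text \<open>(C3) is solved for \<open>a'\<close>, and substitution in (C1) leaves an equation
  without \<open>a'\<close>.\<close>

lemma C1_C3_iff:
  assumes "lam > 0" "a < 1" "sin \<phi> > 0" "cos \<phi> > 0"
  shows "a' \<noteq> -1 \<and> C1 lam \<phi> a a' \<and> C3 lam \<mu>\<^sub>L \<mu>\<^sub>D \<phi> a a'
    \<longleftrightarrow> a' = (1 - a) / (lam * (sin \<phi>)\<^sup>2) * (\<mu>\<^sub>L \<phi> * sin \<phi> - \<mu>\<^sub>D \<phi> * cos \<phi>)
      \<and> 1 / (1 - a) * lam = cot \<phi> - 1 / (sin \<phi>)\<^sup>2 * (\<mu>\<^sub>L \<phi> * sin \<phi> - \<mu>\<^sub>D \<phi> * cos \<phi>)"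
proof -
  define M where "M = 1 / (sin \<phi>)\<^sup>2 * (\<mu>\<^sub>L \<phi> * sin \<phi> - \<mu>\<^sub>D \<phi> * cos \<phi>)"
  have M: "(1 - a) / (lam * (sin \<phi>)\<^sup>2) * (\<mu>\<^sub>L \<phi> * sin \<phi> - \<mu>\<^sub>D \<phi> * cos \<phi>) = (1 - a) / lam * M"
    by (simp add: M_def)
  have 3: "C3 lam \<mu>\<^sub>L \<mu>\<^sub>D \<phi> a a' \<longleftrightarrow> a' = (1 - a) / lam * M"
    using assms by (simp add: C3_def M_def field_simps)
  \<comment> \<open>At \<open>a' = -1\<close> the right side fails as well, because
    \<open>(1 - a) * cot \<phi>\<close> is positive. In the converse direction this is what yields
    \<open>a' \<noteq> -1\<close>.\<close>
  have 1: "a' \<noteq> -1 \<and> C1 lam \<phi> a a' \<longleftrightarrow> lam * (1 + a') = (1 - a) * cot \<phi>"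
  proof (cases "a' = -1")
    case True
    then show ?thesis using assms by (simp add: cot_def)
  next
    case False
    then have "lam * (1 + a') \<noteq> 0" using assms by simp
    then have "C1 lam \<phi> a a' \<longleftrightarrow> sin \<phi> * (lam * (1 + a')) = (1 - a) * cos \<phi>"
      using assms by (simp add: C1_def tan_def frac_eq_eq)
    also have "\<dots> \<longleftrightarrow> lam * (1 + a') = (1 - a) * cot \<phi>"
      using assms by (simp add: cot_def nonzero_eq_divide_eq mult.commute)
    finally show ?thesis using False by simp
  qed
  have "lam * (1 + a') = (1 - a) * cot \<phi> \<longleftrightarrow> 1 / (1 - a) * lam = cot \<phi> - M"
    if "a' = (1 - a) / lam * M"
  proof -
    have "lam * (1 + a') = lam + (1 - a) * M" using that assms by (simp add: distrib_left)
    moreover have "1 / (1 - a) * lam = cot \<phi> - M \<longleftrightarrow> lam = (1 - a) * (cot \<phi> - M)"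
      using assms by (simp add: nonzero_divide_eq_eq mult.commute)
    ultimately show ?thesis by (auto simp: right_diff_distrib)
  qed
  with 1 3 show ?thesis unfolding M M_def[symmetric] by blast
qed

theorem theorem3p5:
  fixes lam \<sigma> \<gamma> \<beta> s \<theta> :: real
    and B :: nat
    and C\<^sub>L C\<^sub>D F \<mu>\<^sub>L \<mu>\<^sub>D \<tau> :: "real \<Rightarrow> real"
    and c :: correction
    and Iplus :: "real set"
  assumes "lam > 0" and "\<sigma> > 0"
    and "-pi/2 < \<gamma>" and "\<gamma> < pi/2"
    and "\<beta> > 0" and "\<bar>\<gamma>\<bar> \<le> \<beta>"
    and "B \<ge> 1" and "0 < s" and "s < 1"
    and "continuous_on {-\<beta>..\<beta>} C\<^sub>L" and "\<forall>x\<in>{0<..\<beta>}. C\<^sub>L x > 0"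
    and "continuous_on UNIV C\<^sub>D" and "\<forall>x. C\<^sub>D x \<ge> 0"
    and "0 < \<theta>" and "\<theta> < pi/2" and "tan \<theta> = 1 / lam"
    and "Iplus = angle_set_plus \<beta> \<gamma> \<theta>"
    and "F = tip_loss c B s"
    and "\<mu>\<^sub>L = mu \<sigma> F C\<^sub>L \<gamma>"
    and "\<mu>\<^sub>D = mu \<sigma> F C\<^sub>D \<gamma>"
    and "\<tau> = tau c F \<theta> \<mu>\<^sub>D"
  shows "(\<forall>\<phi> a a'. \<phi> \<in> Iplus - {pi/2} \<and> a \<in> {0..<1} \<and> a' \<in> UNIV - {-1}
            \<and> C1 lam \<phi> a a' \<and> C2 c F \<mu>\<^sub>L \<mu>\<^sub>D \<phi> a \<and> C3 lam \<mu>\<^sub>L \<mu>\<^sub>D \<phi> a a'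
            \<longrightarrow> \<mu>\<^sub>L \<phi> - tan (\<theta> - \<phi>) * \<mu>\<^sub>D \<phi> = mu_G c F \<theta> \<tau> \<phi>)
       \<and> (\<forall>\<phi> a a'. \<phi> \<in> Iplus - {pi/2}
            \<and> \<mu>\<^sub>L \<phi> - tan (\<theta> - \<phi>) * \<mu>\<^sub>D \<phi> = mu_G c F \<theta> \<tau> \<phi>
            \<and> a = \<tau> \<phi>
            \<and> a' = (1 - \<tau> \<phi>) / (lam * (sin \<phi>)\<^sup>2) * (\<mu>\<^sub>L \<phi> * sin \<phi> - \<mu>\<^sub>D \<phi> * cos \<phi>)
            \<longrightarrow> \<phi> \<in> Iplus - {pi/2} \<and> a \<in> {0..<1} \<and> a' \<in> UNIV - {-1}
              \<and> C1 lam \<phi> a a' \<and> C2 c F \<mu>\<^sub>L \<mu>\<^sub>D \<phi> a \<and> C3 lam \<mu>\<^sub>L \<mu>\<^sub>D \<phi> a a')"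
proof -
  have "sin \<theta> > 0" using assms(14,15) by (intro sin_gt_zero) auto
  then have lam: "lam = cos \<theta> / sin \<theta>"
    using assms(1,16) by (simp add: tan_def field_simps)
  have angles: "sin \<phi> > 0" "cos \<phi> > 0" "cos (\<theta> - \<phi>) > 0" "tan (\<theta> - \<phi>) \<ge> 0" "cos \<theta> > 0"
    if "\<phi> \<in> Iplus" for \<phi>
  proof -
    have "0 < \<phi>" "\<phi> \<le> \<theta>" using that assms(17) by (auto simp: angle_set_plus_def)
    then show "sin \<phi> > 0" "cos \<phi> > 0" "cos (\<theta> - \<phi>) > 0" "cos \<theta> > 0" "tan (\<theta> - \<phi>) \<ge> 0"
      using assms(14,15) by (auto intro!: sin_gt_zero cos_gt_zero_pi tan_pos_pi2_le)
  qed
  define K where "K \<phi> = sin \<theta> * sin \<phi> / cos (\<theta> - \<phi>)" for \<phi>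
  have ex1: "\<exists>!a. a \<in> {0..<1} \<and> tau_lhs c (F \<phi>) (K \<phi>) a = g_rhs \<theta> \<mu>\<^sub>D \<phi>"
    if "\<phi> \<in> Iplus" for \<phi>
  proof (rule tau_lhs_ex1)
    note ang = angles[OF that]
    show F: "F \<phi> > 0" using assms(7-9,18) ang by (simp add: tip_loss_pos)
    show "0 \<le> K \<phi>" using ang \<open>sin \<theta> > 0\<close> by (simp add: K_def)
    \<comment> \<open>The denominator exceeds the numerator by
      \<open>cos \<theta> * cos \<phi>\<close>, which is positive.\<close>
    show "K \<phi> \<le> 1" using ang \<open>sin \<theta> > 0\<close> by (simp add: K_def cos_diff)
    have "\<mu>\<^sub>D \<phi> \<ge> 0" using F assms(2,13,20) by (simp add: mu_def)
    then show "0 \<le> g_rhs \<theta> \<mu>\<^sub>D \<phi>" using ang by (simp add: g_rhs_def cot_def)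
  qed
  have tau: "a = \<tau> \<phi> \<longleftrightarrow> a \<in> {0..<1} \<and> tau_lhs c (F \<phi>) (K \<phi>) a = g_rhs \<theta> \<mu>\<^sub>D \<phi>"
    if "\<phi> \<in> Iplus" for a \<phi>
  proof -
    have "\<tau> \<phi> = (THE a. a \<in> {0..<1} \<and> tau_lhs c (F \<phi>) (K \<phi>) a = g_rhs \<theta> \<mu>\<^sub>D \<phi>)"
      by (simp add: assms(21) tau_def tau_lhs_def K_def)
    with theI'[OF ex1[OF that]] ex1[OF that] show ?thesis by auto
  qed
  \<comment> \<open>Both parts of the theorem are read off from this one equivalence.\<close>
  have main: "a \<in> {0..<1} \<and> a' \<noteq> -1
        \<and> C1 lam \<phi> a a' \<and> C2 c F \<mu>\<^sub>L \<mu>\<^sub>D \<phi> a \<and> C3 lam \<mu>\<^sub>L \<mu>\<^sub>D \<phi> a a'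
      \<longleftrightarrow> a = \<tau> \<phi>
        \<and> a' = (1 - \<tau> \<phi>) / (lam * (sin \<phi>)\<^sup>2) * (\<mu>\<^sub>L \<phi> * sin \<phi> - \<mu>\<^sub>D \<phi> * cos \<phi>)
        \<and> \<mu>\<^sub>L \<phi> - tan (\<theta> - \<phi>) * \<mu>\<^sub>D \<phi> = mu_G c F \<theta> \<tau> \<phi>"
    if \<phi>: "\<phi> \<in> Iplus" for \<phi> a a'
  proof (cases "a \<in> {0..<1}")
    case False
    then show ?thesis using tau[OF \<phi>, of a] by blast
  next
    case True
    note ang = angles[OF \<phi>]
    define P where "P = psi c (F \<phi>) (pos_part (a - a_crit c)) / (1 - a)\<^sup>2"
    have u: "a / (1 - a) = 1 / (1 - a) - 1" using True by (simp add: field_simps)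
    have "C2 c F \<mu>\<^sub>L \<mu>\<^sub>D \<phi> a
        \<longleftrightarrow> 1 / (1 - a) - 1 = 1 / (sin \<phi>)\<^sup>2 * (\<mu>\<^sub>L \<phi> * cos \<phi> + \<mu>\<^sub>D \<phi> * sin \<phi>) - P"
      unfolding C2_def u P_def ..
    moreover have "a = \<tau> \<phi> \<longleftrightarrow> 1 / (1 - a) - 1 + sin \<theta> * sin \<phi> / cos (\<theta> - \<phi>) * P
        = cot \<phi> * tan (\<theta> - \<phi>) + \<mu>\<^sub>D \<phi> / sin \<phi> * (1 + cot \<phi> * tan (\<theta> - \<phi>))"
      using tau[OF \<phi>, of a] True unfolding tau_lhs_def u P_def K_def g_rhs_def by blast
    \<comment> \<open>\<open>mu_G\<close> is evaluated at \<open>\<tau> \<phi>\<close> but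
      \<open>P\<close> at \<open>a\<close>, so (E) takes the form in
      \<open>system_elimination\<close> only together with \<open>a = \<tau> \<phi>\<close>.\<close>
    moreover have "mu_G c F \<theta> \<tau> \<phi>
        = sin \<phi> * tan (\<theta> - \<phi>) + cos \<theta> * (sin \<phi>)\<^sup>2 / cos (\<theta> - \<phi>) * P" if "a = \<tau> \<phi>"
      using that by (simp add: mu_G_def P_def)
    ultimately show ?thesis
      using C1_C3_iff[of lam a \<phi> a' \<mu>\<^sub>L \<mu>\<^sub>D] True assms(1) ang
        system_elimination[OF ang(1) \<open>sin \<theta> > 0\<close> ang(3), of "1 / (1 - a)" "\<mu>\<^sub>L \<phi>" "\<mu>\<^sub>D \<phi>" P,
          folded lam]
      by auto
  qed
  then show ?thesis by blast
qed

end
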